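(* Let $\Omega\subseteq\mathbb{R}^N$ be a bounded domain with $C^2$ boundary. If $\Omega$ is (weakly) analytically convex then $\Omega$ is geometrically convex.
   Context: A domain is a connected open set. $\Omega$ is geometrically convex if for all $P,Q\in\Omega$ the closed segment $\{(1-t)P+tQ:0\le t\le 1\}$ lies in $\Omega$. A $C^k$ function $\rho:\mathbb{R}^N\to\mathbb{R}$ is a $C^k$ defining function for $\Omega$ if $\Omega=\{x:\rho(x)<0\}$, the complement of $\overline{\Omega}$ equals $\{x:\rho(x)>0\}$, and $\nabla\rho(x)\neq 0$ for all $x\in\partial\Omega$. The domain has $C^k$ boundary if it has a $C^k$ defining function. For $P\in\partial\Omega$, $T_P(\partial\Omega)=\{w\in\mathbb{R}^N:\sum_{j=1}^N \frac{\partial\rho}{\partial x_j}(P)w_j=0\}$. A bounded domain $\Omega$ with $C^2$ boundary and $C^2$ defining function $\rho$ is (weakly) analytically convex if for every $P\in\partial\Omega$ one has $\sum_{j,k=1}^N\frac{\partial^2\rho}{\partial x_j\partial x_k}(P)w_jw_k\ge 0$ for all $w\in T_P(\partial\Omega)$ (this does not depend on the choice of $C^2$ defining function). *)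

theory Defs
  imports "HOL-Analysis.Analysis"
begin

text \<open>
  \<open>partial_deriv\<close> is meaningful only where \<open>partially_differentiable\<close> holds; elsewhere
  \<open>deriv\<close> is an unspecified value.
\<close>

definition partially_differentiable :: "'n::finite \<Rightarrow> (real^'n \<Rightarrow> real) \<Rightarrow> real^'n \<Rightarrow> bool" where
  "partially_differentiable i f x \<longleftrightarrow> (\<lambda>t. f (x + t *\<^sub>R axis i 1)) field_differentiable (at 0)"

definition partial_deriv :: "'n::finite \<Rightarrow> (real^'n \<Rightarrow> real) \<Rightarrow> real^'n \<Rightarrow> real" where
  "partial_deriv i f x = deriv (\<lambda>t. f (x + t *\<^sub>R axis i 1)) 0"

fun Ck :: "nat \<Rightarrow> (real^'n::finite \<Rightarrow> real) \<Rightarrow> bool" where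
  "Ck 0 f \<longleftrightarrow> continuous_on UNIV f"
| "Ck (Suc k) f \<longleftrightarrow> continuous_on UNIV f \<and>
     (\<forall>i. (\<forall>x. partially_differentiable i f x) \<and> Ck k (partial_deriv i f))"

definition gradient :: "(real^'n::finite \<Rightarrow> real) \<Rightarrow> real^'n \<Rightarrow> real^'n" where
  "gradient f x = (\<chi> i. partial_deriv i f x)"

definition Ck_defining_function ::
  "nat \<Rightarrow> (real^'n::finite) set \<Rightarrow> (real^'n \<Rightarrow> real) \<Rightarrow> bool" where
  "Ck_defining_function k \<Omega> \<rho> \<longleftrightarrow>
     Ck k \<rho> \<and> \<Omega> = {x. \<rho> x < 0} \<and> - closure \<Omega> = {x. \<rho> x > 0} \<and>
     (\<forall>x\<in>frontier \<Omega>. gradient \<rho> x \<noteq> 0)"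

definition has_Ck_boundary :: "nat \<Rightarrow> (real^'n::finite) set \<Rightarrow> bool" where
  "has_Ck_boundary k \<Omega> \<longleftrightarrow> (\<exists>\<rho>. Ck_defining_function k \<Omega> \<rho>)"

definition tangent_space :: "(real^'n::finite \<Rightarrow> real) \<Rightarrow> real^'n \<Rightarrow> (real^'n) set" where
  "tangent_space \<rho> P = {w. (\<Sum>j\<in>UNIV. partial_deriv j \<rho> P * w $ j) = 0}"

text \<open>
  The condition below does not depend on the choice of the \<open>C\<^sup>2\<close> defining function.  It is therefore
  required of some such function; quantifying universally instead would make it hold vacuously
  for sets without \<open>C\<^sup>2\<close> boundary.
\<close>

definition weakly_analytically_convex :: "(real^'n::finite) set \<Rightarrow> bool" where
  "weakly_analytically_convex \<Omega> \<longleftrightarrow>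
     bounded \<Omega> \<and> open \<Omega> \<and> connected \<Omega> \<and>
     (\<exists>\<rho>. Ck_defining_function 2 \<Omega> \<rho> \<and>
       (\<forall>P\<in>frontier \<Omega>. \<forall>w\<in>tangent_space \<rho> P.
         (\<Sum>j\<in>UNIV. \<Sum>k\<in>UNIV. partial_deriv j (partial_deriv k \<rho>) P * w $ j * w $ k) \<ge> 0))"

end

theory Submission
  imports Defs
begin

text \<open>
  Every boundary point has a ball around it that meets \<open>\<Omega>\<close> in a convex set: for points \<open>a\<close>, \<open>b\<close> of
  \<open>\<Omega>\<close> in such a ball, a slightly concave parabola over the segment from \<open>a\<close> to \<open>b\<close> is slid outward
  from deep inside \<open>\<Omega>\<close>. At a first contact with the boundary, \<open>\<rho>\<close> along the parabola would have an
  interior maximum, whereas weak analytic convexity and the strict concavity of the parabola make its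
  second derivative positive. This uses the condition only at contact points, so weak convexity needs
  neither a perturbation of \<open>\<rho>\<close> nor the implicit function theorem. A segment in the closure of \<open>\<Omega>\<close>
  with endpoints in \<open>\<Omega>\<close> then cannot touch the boundary, so the points of \<open>\<Omega>\<close> visible from a given
  one form a clopen subset.
\<close>

section \<open>Calculus of \<open>Ck\<close> functions: total derivative, chain rule, second
  derivative along a curve\<close>

lemma Ck_imp_continuous: "Ck k f \<Longrightarrow> continuous_on UNIV f"
  by (cases k) auto

lemma has_real_derivative_partial_deriv:
  assumes "\<And>x. partially_differentiable i f x"
  shows "((\<lambda>t. f (x + t *\<^sub>R axis i 1)) has_real_derivative
           partial_deriv i f (x + t *\<^sub>R axis i 1)) (at t)"
proof -
  have "((\<lambda>s. f ((x + t *\<^sub>R axis i 1) + s *\<^sub>R axis i 1)) has_real_derivative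
           partial_deriv i f (x + t *\<^sub>R axis i 1)) (at 0)"
    using assms[of "x + t *\<^sub>R axis i 1"]
    unfolding partially_differentiable_def partial_deriv_def
    by (simp add: DERIV_deriv_iff_field_differentiable)
  then have "((\<lambda>s. f (x + (s + t) *\<^sub>R axis i 1)) has_real_derivative
           partial_deriv i f (x + t *\<^sub>R axis i 1)) (at 0)"
    by (simp add: scaleR_add_left add_ac)
  then show ?thesis
    using DERIV_shift[of "\<lambda>s. f (x + s *\<^sub>R axis i 1)" _ 0 t] by simp
qed

text \<open>Changing one coordinate at a time, so that the mean value theorem applies to each step.\<close>

lemma partial_increment_bound:
  fixes f :: "real^'n::finite \<Rightarrow> real"
  assumes pd: "\<And>i x. partially_differentiable i f x"
    and cont: "\<And>i. continuous_on UNIV (partial_deriv i f)"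
    and "finite A" and "e > 0"
  shows "\<exists>d>0. \<forall>y\<in>ball x d. \<forall>z\<in>ball x d. (\<forall>i. i \<notin> A \<longrightarrow> y $ i = z $ i) \<longrightarrow>
    \<bar>f y - f z - (\<Sum>i\<in>A. partial_deriv i f x * (y - z) $ i)\<bar> \<le> e * norm (y - z)"
  using assms(3,4)
proof (induction A arbitrary: e rule: finite_induct)
  case empty
  have "\<bar>f y - f z\<bar> \<le> e * norm (y - z)" if "\<forall>i. y $ i = z $ i" for y z
  proof -
    have "y = z" using that by (simp add: vec_eq_iff)
    then show ?thesis by simp
  qed
  then show ?case by (intro exI[of _ 1]) simp
next
  case (insert i A)
  obtain d1 where d1': "d1 > 0"
    "\<forall>y\<in>ball x d1. \<forall>z\<in>ball x d1. (\<forall>i. i \<notin> A \<longrightarrow> y $ i = z $ i) \<longrightarrow>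
    \<bar>f y - f z - (\<Sum>i\<in>A. partial_deriv i f x * (y - z) $ i)\<bar> \<le> e/2 * norm (y - z)"
    using insert.IH[OF half_gt_zero[OF insert.prems]] by (elim exE conjE)
  have "isCont (partial_deriv i f) x"
    using cont continuous_on_eq_continuous_at open_UNIV by blast
  then obtain d2 where d2': "d2 > 0"
    "\<And>y. dist y x < d2 \<Longrightarrow> dist (partial_deriv i f y) (partial_deriv i f x) < e/2"
    using half_gt_zero[OF insert.prems] unfolding continuous_at_eps_delta by blast
  have d2: "\<bar>partial_deriv i f y - partial_deriv i f x\<bar> \<le> e/2" if "y \<in> ball x d2" for y
    using d2'(2)[of y] that by (simp add: dist_commute flip: dist_real_def)
  \<comment> \<open>For \<open>y\<close> and \<open>z\<close> within \<open>d\<close> of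
    \<open>x\<close>, their distance is below \<open>2 * d\<close>, so a coordinate step from
    \<open>z\<close> that is no longer than this stays within \<open>3 * d\<close> of
    \<open>x\<close>, inside both balls.\<close>
  define d where "d = min d1 d2 / 3"
  have "\<bar>f y - f z - (\<Sum>i\<in>insert i A. partial_deriv i f x * (y - z) $ i)\<bar> \<le> e * norm (y - z)"
    if y: "y \<in> ball x d" and z: "z \<in> ball x d" and yz: "\<forall>j. j \<notin> insert i A \<longrightarrow> y $ j = z $ j" for y z
  proof -
    define h where "h = y $ i - z $ i"
    \<comment> \<open>\<open>u\<close> is \<open>z\<close> with its coordinate \<open>i\<close>
      taken from \<open>y\<close>. The step from \<open>z\<close> to \<open>u\<close> changes only
      coordinate \<open>i\<close>, the step from \<open>u\<close> to \<open>y\<close> only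
      coordinates in \<open>A\<close>; each may cost half of \<open>e\<close>.\<close>
    define u where "u = z + h *\<^sub>R axis i 1"
    have ui: "u $ j = (if j = i then y $ i else z $ j)" for j
      by (simp add: u_def h_def axis_def)
    have h: "\<bar>h\<bar> \<le> norm (y - z)"
      using component_le_norm_cart[of "y - z" i] by (simp add: h_def)
    have nyz: "norm (y - z) < 2 * d"
      using y z dist_triangle[of y z x] by (simp add: dist_norm norm_minus_commute)
    have step_in: "z + t *\<^sub>R axis i 1 \<in> ball x (3 * d)" if "\<bar>t\<bar> \<le> \<bar>h\<bar>" for t
    proof -
      have "norm (t *\<^sub>R axis i 1 :: real^'n) \<le> norm (y - z)"
        using that h by simp
      moreover have "dist x (z + t *\<^sub>R axis i 1) \<le> dist x z + norm (t *\<^sub>R axis i 1 :: real^'n)"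
        using dist_triangle[of x "z + t *\<^sub>R axis i 1" z] by (simp add: dist_norm)
      ultimately show ?thesis
        using nyz z by simp
    qed
    \<comment> \<open>Subtracting the linear part leaves a function whose derivative is the
      variation of the partial derivative, at most \<open>e/2\<close> on the step.\<close>
    define g where "g t = f (z + t *\<^sub>R axis i 1) - partial_deriv i f x * t" for t
    have "norm (g h - g 0) \<le> e/2 * norm (h - 0)"
    proof (rule field_differentiable_bound)
      show "convex (cball 0 \<bar>h\<bar> :: real set)" by simp
      show "(g has_field_derivative (partial_deriv i f (z + t *\<^sub>R axis i 1) - partial_deriv i f x))
              (at t within cball 0 \<bar>h\<bar>)" for t
        unfolding g_def
        using DERIV_diff[OF has_real_derivative_partial_deriv[OF pd]
            DERIV_cmult_Id[of "partial_deriv i f x"]]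
        by (rule has_field_derivative_at_within)
      show "norm (partial_deriv i f (z + t *\<^sub>R axis i 1) - partial_deriv i f x) \<le> e/2"
        if "t \<in> cball 0 \<bar>h\<bar>" for t
        using that step_in[of t] d2 by (auto simp: d_def)
    qed (auto simp: dist_norm)
    also have "\<dots> \<le> e/2 * norm (y - z)"
      using h insert.prems by (intro mult_left_mono) auto
    finally have i_step: "\<bar>f u - f z - partial_deriv i f x * h\<bar> \<le> e/2 * norm (y - z)"
      by (simp add: g_def u_def algebra_simps)
    have "norm (y - u) \<le> norm (y - z)"
      by (rule norm_le_componentwise_cart) (simp add: ui)
    moreover have "\<bar>f y - f u - (\<Sum>j\<in>A. partial_deriv j f x * (y - u) $ j)\<bar> \<le> e/2 * norm (y - u)"
    proof (rule d1'(2)[THEN bspec, THEN bspec, THEN mp])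
      show "y \<in> ball x d1" using y d1'(1) d2'(1) by (auto simp: d_def)
      show "u \<in> ball x d1" using step_in[of h] by (auto simp: d_def u_def)
      show "\<forall>j. j \<notin> A \<longrightarrow> y $ j = u $ j" using yz by (auto simp: ui)
    qed
    moreover have "(\<Sum>j\<in>A. partial_deriv j f x * (y - u) $ j) = (\<Sum>j\<in>A. partial_deriv j f x * (y - z) $ j)"
      using insert.hyps by (intro sum.cong) (auto simp: ui)
    ultimately have "\<bar>f y - f u - (\<Sum>j\<in>A. partial_deriv j f x * (y - z) $ j)\<bar> \<le> e/2 * norm (y - z)"
      using insert.prems mult_left_mono[of "norm (y - u)" "norm (y - z)" "e/2"] by linarith
    moreover have "(\<Sum>j\<in>insert i A. partial_deriv j f x * (y - z) $ j)
        = partial_deriv i f x * h + (\<Sum>j\<in>A. partial_deriv j f x * (y - z) $ j)"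
      using insert.hyps by (simp add: h_def)
    ultimately show ?thesis
      using i_step by linarith
  qed
  then show ?case
    using d1'(1) d2'(1) by (intro exI[of _ d]) (auto simp: d_def)
qed

text \<open>Continuous partial derivatives give total differentiability: in
  \<open>partial_increment_bound\<close> with \<open>A = UNIV\<close> the condition on the other
  coordinates is vacuous, and \<open>z = x\<close> is admissible.\<close>

lemma Ck_Suc_has_derivative:
  fixes f :: "real^'n::finite \<Rightarrow> real"
  assumes "Ck (Suc k) f"
  shows "(f has_derivative (\<lambda>h. gradient f x \<bullet> h)) (at x)"
proof (rule has_derivativeI)
  show "bounded_linear (\<lambda>h. gradient f x \<bullet> h)"
    by (rule bounded_linear_inner_right)
  have pd: "partially_differentiable i f x" and cont: "continuous_on UNIV (partial_deriv i f)" for i x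
    using assms Ck_imp_continuous by auto
  show "((\<lambda>y. (f y - f x - gradient f x \<bullet> (y - x)) /\<^sub>R norm (y - x)) \<longlongrightarrow> 0) (at x)"
  proof (rule tendstoI)
    fix e :: real assume "e > 0"
    then obtain d where d: "d > 0" "\<And>y z. y\<in>ball x d \<Longrightarrow> z\<in>ball x d \<Longrightarrow>
        \<bar>f y - f z - (\<Sum>i\<in>UNIV. partial_deriv i f x * (y - z) $ i)\<bar> \<le> e/2 * norm (y - z)"
      using partial_increment_bound[OF pd cont, of UNIV "e/2" x] by auto
    have "\<bar>f y - f x - gradient f x \<bullet> (y - x)\<bar> / norm (y - x) < e" if "y \<noteq> x" "dist y x < d" for y
    proof -
      have "\<bar>f y - f x - gradient f x \<bullet> (y - x)\<bar> \<le> e/2 * norm (y - x)"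
        using d(2)[of y x] d(1) that by (simp add: dist_commute inner_vec_def gradient_def)
      also have "\<dots> < e * norm (y - x)"
        using that \<open>e > 0\<close> by simp
      finally show ?thesis
        using that by (simp add: divide_less_eq)
    qed
    then show "\<forall>\<^sub>F y in at x. dist ((f y - f x - gradient f x \<bullet> (y - x)) /\<^sub>R norm (y - x)) 0 < e"
      unfolding eventually_at using d(1)
      by (intro exI[of _ d]) (auto simp: divide_inverse abs_mult mult.commute)
  qed
qed

lemma Ck_Suc_chain_rule:
  fixes f :: "real^'n::finite \<Rightarrow> real"
  assumes "Ck (Suc k) f" and "(\<gamma> has_vector_derivative v) (at s)"
  shows "((\<lambda>s. f (\<gamma> s)) has_real_derivative gradient f (\<gamma> s) \<bullet> v) (at s)"
  using has_derivative_compose[OF assms(2)[unfolded has_vector_derivative_def]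
      Ck_Suc_has_derivative[OF assms(1)]]
  by (rule has_derivative_imp_has_field_derivative) (simp add: mult.commute)

lemma continuous_on_gradient:
  assumes "Ck (Suc k) f"
  shows "continuous_on UNIV (gradient f)"
  unfolding gradient_def using assms Ck_imp_continuous by (intro continuous_on_vec_lambda) auto

definition hessian_form :: "(real^'n::finite \<Rightarrow> real) \<Rightarrow> real^'n \<Rightarrow> real^'n \<Rightarrow> real" where
  "hessian_form f x w =
     (\<Sum>j\<in>UNIV. \<Sum>k\<in>UNIV. partial_deriv j (partial_deriv k f) x * w $ j * w $ k)"

text \<open>When \<gamma>' is the velocity of \<gamma>, this is the second derivative of
  \<open>f\<close> along the curve. Each partial derivative is again C^1, so the chain rule applies
  to it; the acceleration \<open>a\<close> enters through the product rule.\<close>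

lemma gradient_inner_has_derivative:
  fixes f :: "real^'n::finite \<Rightarrow> real"
  assumes "Ck 2 f" and \<gamma>: "(\<gamma> has_vector_derivative \<gamma>' s) (at s)"
    and \<gamma>': "(\<gamma>' has_vector_derivative a) (at s)"
  shows "((\<lambda>s. gradient f (\<gamma> s) \<bullet> \<gamma>' s) has_real_derivative
           hessian_form f (\<gamma> s) (\<gamma>' s) + gradient f (\<gamma> s) \<bullet> a) (at s)"
proof -
  have C: "Ck (Suc 0) (partial_deriv k f)" for k
    using assms(1) unfolding numeral_2_eq_2 Ck.simps(2) by blast
  have comp: "((\<lambda>s. \<gamma>' s $ k) has_real_derivative a $ k) (at s)" for k
    using bounded_linear.has_vector_derivative[OF bounded_linear_vec_nth \<gamma>']
    by (simp add: has_real_derivative_iff_has_vector_derivative)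
  have "((\<lambda>s. \<Sum>k\<in>UNIV. partial_deriv k f (\<gamma> s) * \<gamma>' s $ k) has_real_derivative
      (\<Sum>k\<in>UNIV. gradient (partial_deriv k f) (\<gamma> s) \<bullet> \<gamma>' s * \<gamma>' s $ k
         + a $ k * partial_deriv k f (\<gamma> s))) (at s)"
    by (intro DERIV_sum DERIV_mult Ck_Suc_chain_rule[OF C \<gamma>] comp)
  \<comment> \<open>Both sides differentiate first in \<open>k\<close> and then in \<open>j\<close>,
    so only the order of summation changes.\<close>
  moreover have "(\<Sum>k\<in>UNIV. gradient (partial_deriv k f) (\<gamma> s) \<bullet> \<gamma>' s * \<gamma>' s $ k)
      = hessian_form f (\<gamma> s) (\<gamma>' s)"
    unfolding hessian_form_def inner_vec_def gradient_def
    by (subst sum.swap) (simp add: sum_distrib_right)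
  ultimately show ?thesis
    by (simp add: sum.distrib inner_vec_def gradient_def mult.commute)
qed

section \<open>Maxima and monotonicity along curves and lines\<close>

text \<open>If \<open>l\<close> were positive, \<open>f'\<close> would be positive just to the right
  of its zero \<open>s0\<close>, and by the mean value theorem \<open>f\<close> would exceed
  \<open>f s0\<close> there.\<close>

lemma interior_max_second_derivative_nonpos:
  fixes f :: "real \<Rightarrow> real"
  assumes f: "\<And>s. (f has_real_derivative f' s) (at s)"
    and f': "(f' has_real_derivative l) (at s0)"
    and s0: "s0 \<in> {a<..<b}" and max: "\<And>s. s \<in> {a<..<b} \<Longrightarrow> f s \<le> f s0"
  shows "f' s0 = 0" and "l \<le> 0"
proof -
  show z: "f' s0 = 0"
  proof (rule DERIV_local_max[OF f])
    show "0 < min (s0 - a) (b - s0)" using s0 by simp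
    show "\<forall>y. \<bar>s0 - y\<bar> < min (s0 - a) (b - s0) \<longrightarrow> f y \<le> f s0"
      using max by (simp add: abs_less_iff)
  qed
  show "l \<le> 0"
  proof (rule ccontr)
    assume "\<not> l \<le> 0"
    then obtain d where d: "d > 0" "\<And>h. h > 0 \<Longrightarrow> h < d \<Longrightarrow> f' s0 < f' (s0 + h)"
      using DERIV_pos_inc_right[OF f'] by auto
    define h where "h = min d (b - s0) / 2"
    have h: "0 < h" "h < d" "s0 + h \<in> {a<..<b}"
      using d(1) s0 by (auto simp: h_def min_def field_simps)
    obtain t where t: "s0 < t" "t < s0 + h" "f (s0 + h) - f s0 = (s0 + h - s0) * f' t"
      using MVT2[of s0 "s0 + h" f f'] f h(1) by auto
    have "f' t > 0"
      using d(2)[of "t - s0"] h t z by auto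
    then have "(s0 + h - s0) * f' t > 0"
      using h(1) by simp
    then have "f (s0 + h) > f s0"
      using t(3) by linarith
    with max[OF h(3)] show False by simp
  qed
qed

text \<open>Convexity of \<open>B\<close> keeps the whole path from \<open>x\<close> in the region
  where \<open>v\<close> is a descent direction. For a defining function this means that points of
  \<Omega> pushed along \<open>v\<close> within \<open>B\<close> stay in \<Omega>.\<close>

lemma nonincreasing_against_gradient:
  fixes f :: "real^'n::finite \<Rightarrow> real"
  assumes "Ck (Suc k) f" and "convex B" and neg: "\<And>x. x \<in> B \<Longrightarrow> gradient f x \<bullet> v < 0"
    and "x \<in> B" "x + t *\<^sub>R v \<in> B" "0 \<le> t"
  shows "f (x + t *\<^sub>R v) \<le> f x"
proof -
  have "f (x + t *\<^sub>R v) \<le> f (x + 0 *\<^sub>R v)"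
  proof (rule DERIV_nonpos_imp_nonincreasing[OF \<open>0 \<le> t\<close>])
    fix s assume s: "0 \<le> s" "s \<le> t"
    have "x + s *\<^sub>R v \<in> B"
    proof (cases "t = 0")
      case False
      have "(1 - s/t) *\<^sub>R x + (s/t) *\<^sub>R (x + t *\<^sub>R v) \<in> B"
        using assms s False by (intro convexD) auto
      then show ?thesis using False by (simp add: algebra_simps)
    qed (use s assms in auto)
    moreover have "((\<lambda>s. x + s *\<^sub>R v) has_vector_derivative v) (at s)"
      by (auto intro!: derivative_eq_intros)
    ultimately show "\<exists>y. ((\<lambda>s. f (x + s *\<^sub>R v)) has_real_derivative y) (at s) \<and> y \<le> 0"
      using Ck_Suc_chain_rule[OF assms(1)] neg less_imp_le by blast
  qed
  then show ?thesis by simp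
qed

section \<open>From local convexity at the frontier to convexity\<close>

text \<open>A local-to-global principle in the spirit of Tietze and Nakajima. The set
  \<open>T\<close> of points visible from \<open>p\<close> is open by compactness of segments; its
  relative closedness rests on a second clopen argument, along a single segment.\<close>

lemma convex_of_locally_convex_at_frontier:
  fixes S :: "'a::euclidean_space set"
  assumes "open S" and "connected S"
    and loc: "\<And>p. p \<in> frontier S \<Longrightarrow> \<exists>r>0. convex (S \<inter> ball p r)"
  shows "convex S"
proof -
  have "closed_segment p q \<subseteq> S" if p: "p \<in> S" and q: "q \<in> S" for p q
  proof -
    define T where "T = {q \<in> S. closed_segment p q \<subseteq> S}"
    have "openin (top_of_set S) T"
    proof -
      have "\<exists>e>0. ball q e \<subseteq> T" if "q \<in> T" for q
      proof -
        have "closed_segment p q \<subseteq> S" using that by (simp add: T_def)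
        then obtain e where e: "e > 0" "(\<Union>x\<in>closed_segment p q. ball x e) \<subseteq> S"
          by (rule compact_subset_open_imp_ball_epsilon_subset[OF compact_segment \<open>open S\<close>])
        have "closed_segment p q' \<subseteq> S" if "q' \<in> ball q e" for q'
        proof
          fix x assume "x \<in> closed_segment p q'"
          then obtain u where u: "0 \<le> u" "u \<le> 1" "x = (1 - u) *\<^sub>R p + u *\<^sub>R q'"
            by (auto simp: closed_segment_def)
          \<comment> \<open>The point with the same parameter \<open>u\<close> on the segment to
            \<open>q\<close>: moving the endpoint by less than \<open>e\<close> moves it by less
            than \<open>e\<close>.\<close>
          define y where "y = (1 - u) *\<^sub>R p + u *\<^sub>R q"
          have "y - x = u *\<^sub>R (q - q')"
            by (simp add: y_def u(3) algebra_simps)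
          then have "dist y x = u * dist q q'"
            using u(1) by (simp add: dist_norm)
          also have "\<dots> \<le> dist q q'"
            using u(1,2) by (simp add: mult_left_le_one_le)
          also have "\<dots> < e"
            using that by simp
          finally have "x \<in> ball y e" by simp
          moreover have "y \<in> closed_segment p q"
            using u by (auto simp: y_def closed_segment_def)
          ultimately show "x \<in> S" using e(2) by blast
        qed
        then have "ball q e \<subseteq> T"
          unfolding T_def using ends_in_segment(2) by fast
        then show ?thesis using e(1) by blast
      qed
      then have "open T" by (simp add: open_contains_ball)
      then show ?thesis by (simp add: T_def openin_open_eq \<open>open S\<close>)
    qed
    moreover have "closedin (top_of_set S) T"
    proof -
      have "q \<in> T" if q: "q \<in> S" "q \<in> closure T" for q
      proof -
        define c where "c t = (1 - t) *\<^sub>R p + t *\<^sub>R q" for t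
        obtain Q where Q: "\<And>n. Q n \<in> T" "Q \<longlonglongrightarrow> q"
          using q(2) by (auto simp: closure_sequential)
        \<comment> \<open>Each point of the limit segment is a limit of points with the same
          parameter on visible segments.\<close>
        have cl: "c t \<in> closure S" if "t \<in> {0..1}" for t
        proof -
          have "(\<lambda>n. (1 - t) *\<^sub>R p + t *\<^sub>R Q n) \<longlonglongrightarrow> c t"
            unfolding c_def by (intro tendsto_intros Q)
          moreover have "(1 - t) *\<^sub>R p + t *\<^sub>R Q n \<in> S" for n
            using Q(1)[of n] that by (auto simp: T_def closed_segment_def)
          ultimately show ?thesis unfolding closure_sequential by (intro exI conjI allI)
        qed
        have contc: "continuous_on UNIV c"
          unfolding c_def by (intro continuous_intros)
        \<comment> \<open>\<open>J\<close> will be clopen in the unit interval, hence all of it;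
          local convexity enters in its closedness.\<close>
        define J where "J = {t \<in> {0..1}. c t \<in> S}"
        have "openin (top_of_set {0..1}) J"
          unfolding J_def
          using continuous_openin_preimage_gen[OF continuous_on_subset[OF contc] \<open>open S\<close>, of "{0..1}"]
          by (simp add: vimage_def Int_def)
        moreover have "closedin (top_of_set {0..1}) J"
        proof -
          have "t \<in> J" if t: "t \<in> {0..1}" "t \<in> closure J" for t
          proof (rule ccontr)
            assume "t \<notin> J"
            then have "c t \<notin> S" using t by (simp add: J_def)
            then have "c t \<in> frontier S"
              using cl t(1) \<open>open S\<close> by (simp add: frontier_def interior_open)
            then obtain r where r: "r > 0" "convex (S \<inter> ball (c t) r)"
              using loc by blast
            have "0 < t" "t < 1"
              using \<open>c t \<notin> S\<close> t(1) p q(1) by (auto simp: c_def less_le)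
            obtain d where d0: "d > 0" "\<And>s. dist s t < d \<Longrightarrow> dist (c s) (c t) < r"
              using contc r(1) unfolding continuous_on_iff by blast
            have d: "c s \<in> ball (c t) r" if "\<bar>s - t\<bar> < d" for s
              using d0(2)[of s] that by (simp add: dist_real_def dist_commute)
            \<comment> \<open>Parameters within \<open>m\<close> of \<open>t\<close> stay in the
              unit interval and are mapped into the ball, and so are their mirror images in
              \<open>t\<close>.\<close>
            define m where "m = Min {d, t, 1 - t}"
            have m: "m > 0" "m \<le> d" "m \<le> t" "m \<le> 1 - t"
              using d0(1) \<open>0 < t\<close> \<open>t < 1\<close> by (auto simp: m_def)
            obtain s where s: "s \<in> J" "\<bar>s - t\<bar> < m"
              using t(2) m(1) unfolding closure_approachable dist_real_def by auto
            \<comment> \<open>The reflection of \<open>s\<close> in \<open>t\<close> makes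
              \<open>c t\<close> the midpoint of \<open>c s\<close> and \<open>c s'\<close>. Of the
              latter it is only known that it lies in the closure.\<close>
            define s' where "s' = t + (t - s)"
            have s': "s' \<in> {0..1}" "\<bar>s' - t\<bar> < m"
              using s(2) m by (auto simp: s'_def)
            have a: "c s \<in> interior (S \<inter> ball (c t) r)"
              using s m d[of s] \<open>open S\<close> by (simp add: J_def interior_open)
            have b: "c s' \<in> closure (S \<inter> ball (c t) r)"
              using cl[OF s'(1)] s'(2) m d[of s']
                open_Int_closure_subset[of "ball (c t) r" S] by (auto simp: Int_commute)
            have "c t = p + t *\<^sub>R (q - p)" for t
              by (simp add: c_def algebra_simps)
            then have shift: "c (t + u) = c t + u *\<^sub>R (q - p)" for u
              by (simp add: scaleR_left_distrib)
            have cs: "c s = c t + (s - t) *\<^sub>R (q - p)"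
              using shift[of "s - t"] by simp
            have cs': "c s' = c t + (t - s) *\<^sub>R (q - p)"
              unfolding s'_def by (rule shift)
            have "(s - t) *\<^sub>R (q - p) + (t - s) *\<^sub>R (q - p) = ((s - t) + (t - s)) *\<^sub>R (q - p)"
              by (rule scaleR_left_distrib[symmetric])
            also have "\<dots> = 0" by simp
            finally have "c s + c s' = c t + c t"
              unfolding cs cs' by (simp add: add.assoc add.left_commute del: scaleR_cancel_right)
            then have "(1/2) *\<^sub>R (c s + c s') = c t"
              by (simp only: scaleR_half_double)
            then have mid: "c t = (1 - 1/2) *\<^sub>R c s + (1/2) *\<^sub>R c s'"
              unfolding scaleR_right_distrib by simp
            have "c s \<noteq> c s'"
            proof
              assume "c s = c s'"
              then have "c t = c s"
                using mid by (simp flip: scaleR_add_left)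
              then show False using \<open>c t \<notin> S\<close> s(1) by (simp add: J_def)
            qed
            then have "c t \<in> open_segment (c s) (c s')"
              unfolding in_segment using mid by (intro conjI exI[of _ "1/2"]) simp_all
            \<comment> \<open>In a convex set, an open segment from an interior point to a point of
              the closure consists of interior points.\<close>
            then have "c t \<in> interior (S \<inter> ball (c t) r)"
              by (rule subsetD[OF in_interior_closure_convex_segment[OF r(2) a b]])
            then show False using \<open>c t \<notin> S\<close> interior_subset by blast
          qed
          then have "J = {0..1} \<inter> closure J"
            using closure_subset[of J] unfolding J_def by blast
          then show ?thesis
            unfolding closedin_closed using closed_closure by blast
        qed
        moreover have "0 \<in> J" using p by (simp add: J_def c_def)
        ultimately have J: "J = {0..1}"
          using connected_clopen[of "{0..1::real}"] connected_Icc[of 0 "1::real"] by blast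
        have "x \<in> S" if "x \<in> closed_segment p q" for x
        proof -
          obtain u where u: "u \<in> {0..1}" "x = c u"
            using \<open>x \<in> closed_segment p q\<close> unfolding in_segment c_def by auto
          then have "u \<in> J" by (simp only: J)
          then show ?thesis by (simp add: J_def u(2))
        qed
        then show ?thesis
          using q(1) unfolding T_def by blast
      qed
      then have "T = S \<inter> closure T"
        using closure_subset[of T] unfolding T_def by blast
      then show ?thesis
        unfolding closedin_closed using closed_closure by blast
    qed
    moreover have "p \<in> T" using p by (simp add: T_def)
    ultimately have "T = S"
      using \<open>connected S\<close> unfolding connected_clopen by blast
    then show ?thesis using q by (auto simp: T_def)
  qed
  then show ?thesis by (simp add: convex_contains_segment)
qed

section \<open>Local convexity at the boundary by sliding parabolas\<close>

lemma defining_function_frontier: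
  assumes "Ck_defining_function k \<Omega> \<rho>" and "open \<Omega>"
  shows "x \<in> frontier \<Omega> \<longleftrightarrow> \<rho> x = 0"
proof -
  have "x \<in> \<Omega> \<longleftrightarrow> \<rho> x < 0" "x \<in> closure \<Omega> \<longleftrightarrow> \<not> \<rho> x > 0"
    using assms(1) unfolding Ck_defining_function_def by auto
  then show ?thesis
    using assms(2) by (auto simp: frontier_def interior_open)
qed

text \<open>At a contact point the velocity is tangent to the boundary, and the acceleration \<open>- 2 \<delta> v\<close>
  makes the second derivative of \<open>\<rho>\<close> along the parabola positive.\<close>

lemma parabola_no_interior_contact:
  fixes \<rho> :: "real^'n::finite \<Rightarrow> real"
  assumes "Ck 2 \<rho>" and "\<delta> > 0" and s0: "s0 \<in> {0<..<1}"
    and "gradient \<rho> (x + s0 *\<^sub>R w - (\<delta> * s0\<^sup>2) *\<^sub>R v) \<bullet> v < 0"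
    and hess: "\<And>u. gradient \<rho> (x + s0 *\<^sub>R w - (\<delta> * s0\<^sup>2) *\<^sub>R v) \<bullet> u = 0 \<Longrightarrow>
           hessian_form \<rho> (x + s0 *\<^sub>R w - (\<delta> * s0\<^sup>2) *\<^sub>R v) u \<ge> 0"
    and max: "\<And>s. s \<in> {0<..<1} \<Longrightarrow> \<rho> (x + s *\<^sub>R w - (\<delta> * s\<^sup>2) *\<^sub>R v)
           \<le> \<rho> (x + s0 *\<^sub>R w - (\<delta> * s0\<^sup>2) *\<^sub>R v)"
  shows False
proof -
  define \<gamma> where "\<gamma> s = x + s *\<^sub>R w - (\<delta> * s\<^sup>2) *\<^sub>R v" for s
  define \<gamma>' where "\<gamma>' s = w - (2 * \<delta> * s) *\<^sub>R v" for s
  have \<gamma>: "(\<gamma> has_vector_derivative \<gamma>' s) (at s)" for s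
    unfolding \<gamma>_def \<gamma>'_def by (auto intro!: derivative_eq_intros)
  have \<gamma>': "(\<gamma>' has_vector_derivative - (2 * \<delta>) *\<^sub>R v) (at s)" for s
    unfolding \<gamma>'_def by (auto intro!: derivative_eq_intros)
  have f1: "((\<lambda>s. \<rho> (\<gamma> s)) has_real_derivative gradient \<rho> (\<gamma> s) \<bullet> \<gamma>' s) (at s)" for s
    using Ck_Suc_chain_rule[OF _ \<gamma>] assms(1) numeral_2_eq_2 by metis
  note f2 = gradient_inner_has_derivative[OF assms(1) \<gamma> \<gamma>', of s0]
  note crit = interior_max_second_derivative_nonpos[OF f1 f2 s0]
  have "gradient \<rho> (\<gamma> s0) \<bullet> \<gamma>' s0 = 0"
    by (rule crit(1)) (use max in \<open>simp add: \<gamma>_def\<close>)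
  then have "hessian_form \<rho> (\<gamma> s0) (\<gamma>' s0) \<ge> 0"
    using hess by (simp add: \<gamma>_def)
  moreover have "hessian_form \<rho> (\<gamma> s0) (\<gamma>' s0) + gradient \<rho> (\<gamma> s0) \<bullet> (- (2 * \<delta>) *\<^sub>R v) \<le> 0"
    by (rule crit(2)) (use max in \<open>simp add: \<gamma>_def\<close>)
  ultimately have "\<delta> * (gradient \<rho> (\<gamma> s0) \<bullet> v) \<ge> 0" by simp
  then show False
    using assms(2,4) by (simp add: \<gamma>_def zero_le_mult_iff)
qed

text \<open>The scales are chosen in turn: on \<open>ball p r\<close> the direction \<open>v\<close>
  is one of strict descent for \<rho>; the depth \<open>h\<close> puts \<open>p + h v\<close> inside
  \<Omega>; \<open>e\<close> is the radius of a ball around that point still in \<Omega>. The convex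
  neighbourhood has radius \<open>e/2\<close>.\<close>

lemma locally_convex_at_frontier:
  fixes \<Omega> :: "(real^'n::finite) set"
  assumes \<rho>: "Ck_defining_function 2 \<Omega> \<rho>" and "open \<Omega>"
    and hess: "\<And>x u. x \<in> frontier \<Omega> \<Longrightarrow> gradient \<rho> x \<bullet> u = 0 \<Longrightarrow> hessian_form \<rho> x u \<ge> 0"
    and p: "p \<in> frontier \<Omega>"
  shows "\<exists>r>0. convex (\<Omega> \<inter> ball p r)"
proof -
  have C2: "Ck 2 \<rho>" and \<Omega>: "x \<in> \<Omega> \<longleftrightarrow> \<rho> x < 0" for x
    using \<rho> unfolding Ck_defining_function_def by auto
  then have C1: "Ck (Suc (Suc 0)) \<rho>" by (simp only: numeral_2_eq_2)
  have cont: "continuous_on A \<rho>" for A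
    using Ck_imp_continuous[OF C2] continuous_on_subset by blast
  define v where "v = - gradient \<rho> p"
  have "open {x. gradient \<rho> x \<bullet> v < 0}"
    by (intro open_Collect_less continuous_intros continuous_on_gradient[OF C1])
  moreover have "gradient \<rho> p \<bullet> v < 0"
    using \<rho> p by (simp add: v_def Ck_defining_function_def)
  ultimately obtain r where r: "r > 0" and neg: "\<And>x. x \<in> ball p r \<Longrightarrow> gradient \<rho> x \<bullet> v < 0"
    unfolding open_contains_ball by blast
  note mono = nonincreasing_against_gradient[OF C1 convex_ball[of p r] neg]
  have "((\<lambda>t. p + t *\<^sub>R v) has_vector_derivative v) (at 0)"
    by (auto intro!: derivative_eq_intros)
  from Ck_Suc_chain_rule[OF C1 this]
  have inward: "((\<lambda>t. \<rho> (p + t *\<^sub>R v)) has_real_derivative gradient \<rho> p \<bullet> v) (at 0)"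
    by simp
  then obtain d where d: "d > 0" "\<And>t. 0 < t \<Longrightarrow> t < d \<Longrightarrow> \<rho> (p + t *\<^sub>R v) < \<rho> p"
    using DERIV_neg_dec_right[OF inward \<open>gradient \<rho> p \<bullet> v < 0\<close>] by auto
  have "((\<lambda>t. norm (t *\<^sub>R v)) \<longlongrightarrow> norm (0 *\<^sub>R v)) (at_right 0)"
    by (intro tendsto_intros)
  then have "\<forall>\<^sub>F t in at_right 0. norm (t *\<^sub>R v) < r/2"
    using r by (intro order_tendstoD) auto
  moreover have "\<forall>\<^sub>F t in at_right 0. t \<in> {0<..<d}"
    using d(1) by (rule eventually_at_right_real)
  ultimately have "\<forall>\<^sub>F t in at_right 0. norm (t *\<^sub>R v) < r/2 \<and> t \<in> {0<..<d}"
    by eventually_elim simp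
  then obtain h where h: "norm (h *\<^sub>R v) < r/2" "0 < h" "h < d"
    using eventually_happens'[OF trivial_limit_at_right_real] by fastforce
  have "p + h *\<^sub>R v \<in> \<Omega>"
    using d(2)[OF h(2,3)] p defining_function_frontier[OF \<rho> \<open>open \<Omega>\<close>] \<Omega> by simp
  then obtain e0 where e0: "e0 > 0" "ball (p + h *\<^sub>R v) e0 \<subseteq> \<Omega>"
    using \<open>open \<Omega>\<close> unfolding open_contains_ball by blast
  \<comment> \<open>The bound \<open>r/2\<close> is for \<open>c_ball\<close>: a distance below
    \<open>e\<close> from \<open>p + t v\<close>, plus a shift shorter than \<open>r/2\<close>,
    stays within \<open>r\<close> of \<open>p\<close>.\<close>
  define e where "e = min e0 (r/2)"
  have e: "e > 0" "e \<le> r/2" "ball (p + h *\<^sub>R v) e \<subseteq> \<Omega>"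
    using e0 r by (auto simp: e_def)
  \<comment> \<open>The radius is \<open>e/2\<close> because the other half of \<open>e\<close> is
    spent on the sag of the parabola below the chord.\<close>
  have "closed_segment a b \<subseteq> \<Omega> \<inter> ball p (e/2)"
    if a: "a \<in> \<Omega> \<inter> ball p (e/2)" and b: "b \<in> \<Omega> \<inter> ball p (e/2)" for a b
  proof -
    define w where "w = b - a"
    have seg: "a + s *\<^sub>R w \<in> ball p (e/2)" if "s \<in> {0..1}" for s
    proof -
      have "(1 - s) *\<^sub>R a + s *\<^sub>R b \<in> ball p (e/2)"
        using a b that by (intro convexD convex_ball) auto
      then show ?thesis by (simp add: w_def algebra_simps)
    qed
    have "((\<lambda>t. b - t *\<^sub>R v) \<longlongrightarrow> b - 0 *\<^sub>R v) (at_right 0)"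
      by (intro tendsto_intros)
    then have "\<forall>\<^sub>F t in at_right 0. b - t *\<^sub>R v \<in> \<Omega>"
      using b \<open>open \<Omega>\<close> by (intro topological_tendstoD) auto
    moreover have "((\<lambda>t. norm (t *\<^sub>R v)) \<longlongrightarrow> norm (0 *\<^sub>R v)) (at_right 0)"
      by (intro tendsto_intros)
    then have "\<forall>\<^sub>F t in at_right 0. norm (t *\<^sub>R v) < e/2"
      using e(1) by (intro order_tendstoD) auto
    moreover have "\<forall>\<^sub>F t in at_right 0. t \<in> {0<..<1::real}"
      by (rule eventually_at_right_real) simp
    ultimately have "\<forall>\<^sub>F t in at_right 0. b - t *\<^sub>R v \<in> \<Omega> \<and> norm (t *\<^sub>R v) < e/2 \<and> t \<in> {0<..<1}"
      by eventually_elim simp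
    then obtain \<delta> where \<delta>: "b - \<delta> *\<^sub>R v \<in> \<Omega>" "norm (\<delta> *\<^sub>R v) < e/2" "0 < \<delta>"
      using eventually_happens'[OF trivial_limit_at_right_real] by fastforce
    \<comment> \<open>For \<open>t = 0\<close> the parabola runs from \<open>a\<close> to the
      lowered endpoint \<open>b - \<delta> v\<close>, which the choice of \<delta> keeps in
      \<Omega>; \<open>t\<close> translates it inward.\<close>
    define c where "c t s = (a + t *\<^sub>R v) + s *\<^sub>R w - (\<delta> * s\<^sup>2) *\<^sub>R v" for t s
    have small: "norm ((\<delta> * s\<^sup>2) *\<^sub>R v) < e/2" if "s \<in> {0..1}" for s
    proof -
      have "s\<^sup>2 \<le> 1" using that by (simp add: power_le_one)
      then have "\<delta> * s\<^sup>2 * norm v \<le> \<delta> * 1 * norm v"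
        using \<delta>(3) by (intro mult_mono) auto
      then have "norm ((\<delta> * s\<^sup>2) *\<^sub>R v) \<le> norm (\<delta> *\<^sub>R v)"
        using \<delta>(3) by simp
      then show ?thesis using \<delta>(2) by linarith
    qed
    have near: "dist (p + t *\<^sub>R v) (c t s) < e" if "s \<in> {0..1}" for t s
    proof -
      have "p + t *\<^sub>R v - c t s = (p - (a + s *\<^sub>R w)) + (\<delta> * s\<^sup>2) *\<^sub>R v"
        by (simp add: c_def)
      then have "dist (p + t *\<^sub>R v) (c t s) \<le> dist p (a + s *\<^sub>R w) + norm ((\<delta> * s\<^sup>2) *\<^sub>R v)"
        by (metis dist_norm norm_triangle_ineq)
      then show ?thesis using seg[OF that] small[OF that] by simp
    qed
    have c_ball: "c t s \<in> ball p r" if "t \<in> {0..h}" "s \<in> {0..1}" for t s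
    proof -
      have "norm (t *\<^sub>R v) \<le> norm (h *\<^sub>R v)"
        using that by (auto intro: mult_right_mono)
      then have "dist p (p + t *\<^sub>R v) < r/2" using h by (simp add: dist_norm)
      then show ?thesis
        using near[OF that(2), of t] dist_triangle[of p "c t s" "p + t *\<^sub>R v"] e(2) by simp
    qed
    have c_mono: "\<rho> (c t s) \<le> \<rho> (c 0 s)" if "t \<in> {0..h}" "s \<in> {0..1}" for t s
    proof -
      have "c t s = c 0 s + t *\<^sub>R v" by (simp add: c_def)
      then show ?thesis
        using mono[of "c 0 s" t] c_ball[of t s] c_ball[of 0 s] that h(2) by simp
    qed
    \<comment> \<open>On three sides of the parameter rectangle the parabolas lie in \<Omega>: the
      endpoints start there and are pushed inward, and at depth \<open>h\<close> the whole curve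
      lies in the ball of radius \<open>e\<close>. A contact thus has \<open>t < h\<close> and
      \<open>s\<close> strictly between 0 and 1.\<close>
    have ends: "\<rho> (c t s) < 0" if "t \<in> {0..h}" "s = 0 \<or> s = 1 \<or> t = h" "s \<in> {0..1}" for t s
      using that(2)
    proof (elim disjE)
      assume "t = h"
      then show ?thesis using near[OF that(3), of h] e(3) \<Omega> by auto
    next
      assume "s = 0"
      then have "c 0 s \<in> \<Omega>" using a by (simp add: c_def)
      then show ?thesis using c_mono[OF that(1,3)] \<Omega>[of "c 0 s"] by simp
    next
      assume "s = 1"
      then have "c 0 s \<in> \<Omega>" using \<delta>(1) by (simp add: c_def w_def)
      then show ?thesis using c_mono[OF that(1,3)] \<Omega>[of "c 0 s"] by simp
    qed
    have contc: "continuous_on A (\<lambda>x. \<rho> (c (fst x) (snd x)))" for A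
      unfolding c_def by (intro continuous_on_compose2[OF cont[of UNIV]] continuous_intros) auto
    define K where "K = ({0..h} \<times> {0..1}) \<inter> {x. \<rho> (c (fst x) (snd x)) \<ge> 0}"
    have "K = {}"
    proof (rule ccontr)
      assume "K \<noteq> {}"
      have "closed {x. \<rho> (c (fst x) (snd x)) \<ge> 0}"
        by (intro closed_Collect_le contc continuous_intros)
      then have "compact K"
        unfolding K_def by (intro compact_Int_closed compact_Times) auto
      then obtain x where x: "x \<in> K" and xmax: "\<And>y. y \<in> K \<Longrightarrow> fst y \<le> fst x"
        using continuous_attains_sup[OF _ \<open>K \<noteq> {}\<close> continuous_on_fst[OF continuous_on_id]] by blast
      \<comment> \<open>sliding outward means decreasing \<open>t\<close>, so the largest \<open>t\<close> gives the first contact\<close>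
      obtain t0 s0 where ts: "x = (t0, s0)" by (cases x)
      have K0: "t0 \<in> {0..h}" "s0 \<in> {0..1}" "\<rho> (c t0 s0) \<ge> 0"
        using x by (auto simp: K_def ts)
      then have lt: "t0 < h" "s0 \<in> {0<..<1}"
        using ends[of t0 s0] by (auto simp: less_le)
      \<comment> \<open>Parabolas with \<open>t\<close> slightly above \<open>t0\<close> lie in
        \<Omega> by maximality of \<open>t0\<close>; continuity in \<open>t\<close> leaves the weak
        inequality at \<open>t0\<close>. So \<open>s0\<close> maximizes \<rho> along the contact
        parabola, with value 0.\<close>
      have le0: "\<rho> (c t0 s) \<le> 0" if "s \<in> {0..1}" for s
      proof -
        have "continuous_on UNIV (\<lambda>t. \<rho> (c t s))"
          unfolding c_def by (intro continuous_on_compose2[OF cont[of UNIV]] continuous_intros) auto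
        then have "isCont (\<lambda>t. \<rho> (c t s)) t0"
          by (simp add: continuous_on_eq_continuous_at)
        then have "((\<lambda>t. \<rho> (c t s)) \<longlongrightarrow> \<rho> (c t0 s)) (at_right t0)"
          by (simp add: isCont_def filterlim_at_split)
        moreover have "\<forall>\<^sub>F t in at_right t0. \<rho> (c t s) \<le> 0"
          using eventually_at_right_real[OF lt(1)]
        proof eventually_elim
          case (elim t)
          then have "(t, s) \<notin> K" using xmax[of "(t, s)"] by (auto simp: ts)
          then show ?case using elim K0(1) that by (auto simp: K_def)
        qed
        ultimately show ?thesis
          by (intro tendsto_upperbound) auto
      qed
      have eq0: "\<rho> (c t0 s0) = 0"
        using le0[OF K0(2)] K0(3) by simp
      then have fr: "c t0 s0 \<in> frontier \<Omega>"
        using defining_function_frontier[OF \<rho> \<open>open \<Omega>\<close>] by simp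
      show False
      proof (rule parabola_no_interior_contact[OF C2 \<delta>(3) lt(2), of "a + t0 *\<^sub>R v" w v, folded c_def])
        show "gradient \<rho> (c t0 s0) \<bullet> v < 0"
          using neg c_ball[OF K0(1,2)] by blast
        show "hessian_form \<rho> (c t0 s0) u \<ge> 0" if "gradient \<rho> (c t0 s0) \<bullet> u = 0" for u
          using hess[OF fr that] .
        show "\<rho> (c t0 s) \<le> \<rho> (c t0 s0)" if "s \<in> {0<..<1}" for s
          using le0[of s] that eq0 by simp
      qed
    qed
    \<comment> \<open>The chord is recovered from the parabola at \<open>t = 0\<close>: its point at
      parameter \<open>s\<close> arises by moving inward by \<open>(\<delta> * s\<^sup>2) v\<close>,
      which does not increase \<rho>. The same fixed \<delta> serves throughout.\<close>
    have "a + s *\<^sub>R w \<in> \<Omega>" if s: "s \<in> {0..1}" for s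
    proof -
      have "\<rho> (c 0 s) < 0"
        using s h(2) equals0D[OF \<open>K = {}\<close>, of "(0, s)"] by (simp add: K_def)
      moreover have "a + s *\<^sub>R w = c 0 s + (\<delta> * s\<^sup>2) *\<^sub>R v" by (simp add: c_def)
      moreover have "a + s *\<^sub>R w \<in> ball p r" using seg[OF s] e r by auto
      ultimately have "\<rho> (a + s *\<^sub>R w) < 0"
        using mono[of "c 0 s" "\<delta> * s\<^sup>2"] c_ball[of 0 s] s h(2) \<delta>(3) by auto
      then show ?thesis using \<Omega> by simp
    qed
    then have "a + s *\<^sub>R w \<in> \<Omega> \<inter> ball p (e/2)" if "s \<in> {0..1}" for s
      using seg that by blast
    moreover have "\<exists>s\<in>{0..1}. y = a + s *\<^sub>R w" if "y \<in> closed_segment a b" for y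
      using that by (auto simp: closed_segment_def w_def algebra_simps)
    ultimately show ?thesis by blast
  qed
  then have "convex (\<Omega> \<inter> ball p (e/2))"
    unfolding convex_contains_segment by blast
  then show ?thesis
    using e(1) by (intro exI[of _ "e/2"]) simp
qed

theorem proposition6:
  fixes \<Omega> :: "(real^'n::finite) set"
  assumes "bounded \<Omega>" and "open \<Omega>" and "connected \<Omega>"
    and "has_Ck_boundary 2 \<Omega>"
    and "weakly_analytically_convex \<Omega>"
  shows "convex \<Omega>"
proof -
  obtain \<rho> where \<rho>: "Ck_defining_function 2 \<Omega> \<rho>"
    and hess: "\<And>P w. P \<in> frontier \<Omega> \<Longrightarrow> w \<in> tangent_space \<rho> P \<Longrightarrow> hessian_form \<rho> P w \<ge> 0"
    using assms(5) unfolding weakly_analytically_convex_def hessian_form_def by blast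
  have "w \<in> tangent_space \<rho> P \<longleftrightarrow> gradient \<rho> P \<bullet> w = 0" for P w
    by (simp add: tangent_space_def gradient_def inner_vec_def)
  with hess show ?thesis
    using convex_of_locally_convex_at_frontier[OF \<open>open \<Omega>\<close> \<open>connected \<Omega>\<close>]
      locally_convex_at_frontier[OF \<rho> \<open>open \<Omega>\<close>] by blast
qed

end
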